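(* Let $D\subseteq\mathbb{R}^n$ be an open convex set and let $F: D\to\mathbb{R}^n$ be sufficiently Fréchet differentiable in $D$. Let $\alpha\in D$ satisfy $F(\alpha)=0$, and suppose that $F'(X)$ is continuous and nonsingular in $D$. For real parameters $\beta,a_1,a_2,a_3$ consider the iteration $$Y^{(k)}=X^{(k)}-\beta\,[F'(X^{(k)})]^{-1}F(X^{(k)}),$$ $$X^{(k+1)}=X^{(k)}-\tfrac12\left[3I-T^{(k)}\right]\left[a_1I+a_2T^{(k)}+a_3\left(T^{(k)}\right)^2\right][F'(X^{(k)})]^{-1}F(X^{(k)}),$$ where $T^{(k)}=[F'(X^{(k)})]^{-1}F'(Y^{(k)})$. Then, for $\beta=\frac23$, $a_1=\frac94$, $a_2=-\frac94$, $a_3=1$, and for $X^{(0)}$ sufficiently close to $\alpha$, the sequence $\{X^{(k)}\}_{k\ge 0}$ obtained by this iteration converges to $\alpha$ with order four.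
   Context: $F'(X)$ denotes the Jacobian matrix (Fréchet derivative) of $F$ at $X$, and $I$ is the $n\times n$ identity matrix. "Sufficiently Fréchet differentiable" means that $F$ has continuous Fréchet derivatives in $D$ of all orders needed for local Taylor expansions at $\alpha$ (expansions of $F$ with remainder $O(\|H\|^6)$ are used, so $F\in C^6(D)$ is an adequate reading). "For $X^{(0)}$ sufficiently close to $\alpha$" means: there is a neighborhood of $\alpha$ such that the iterates are well defined and the conclusion holds for every $X^{(0)}$ in that neighborhood. With $E^{(k)}=X^{(k)}-\alpha$, "converges to $\alpha$ with order $p$" means that $X^{(k)}\to\alpha$ and there is a constant $C$ with $\|E^{(k+1)}\|\le C\|E^{(k)}\|^p$ for all $k$ (order at least $p$). *)

theory Defs
  imports "HOL-Analysis.Analysis"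
begin

definition frechet_derivative_on ::
  "'a set \<Rightarrow> ('a::real_normed_vector \<Rightarrow> 'b::real_normed_vector) \<Rightarrow> ('a \<Rightarrow> 'a \<Rightarrow>\<^sub>L 'b) \<Rightarrow> bool"
  where "frechet_derivative_on D f f' \<longleftrightarrow>
    (\<forall>x\<in>D. (f has_derivative blinfun_apply (f' x)) (at x))"

(* The k-th Frechet derivative is a map into the k-fold nested space of bounded linear maps;
   its type depends on k, so the order is unfolded here rather than given as an argument.
   Meant for open D. Continuity of f and F1, ..., F5 follows from differentiability. *)
definition C6_on ::
  "'a set \<Rightarrow> ('a::real_normed_vector \<Rightarrow> 'b::real_normed_vector) \<Rightarrow> bool"
  where "C6_on D f \<longleftrightarrow>
    (\<exists>F1 F2 F3 F4 F5 F6.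
       frechet_derivative_on D f F1 \<and> frechet_derivative_on D F1 F2 \<and>
       frechet_derivative_on D F2 F3 \<and> frechet_derivative_on D F3 F4 \<and>
       frechet_derivative_on D F4 F5 \<and> frechet_derivative_on D F5 F6 \<and>
       continuous_on D F6)"

abbreviation jac :: "(real^'n \<Rightarrow> real^'n) \<Rightarrow> real^'n \<Rightarrow> real^'n^'n"
  where "jac F x \<equiv> jacobian F (at x)"

definition newton_corr :: "(real^'n \<Rightarrow> real^'n) \<Rightarrow> real^'n \<Rightarrow> real^'n"
  where "newton_corr F x = matrix_inv (jac F x) *v F x"

definition Y_step :: "(real^'n \<Rightarrow> real^'n) \<Rightarrow> real \<Rightarrow> real^'n \<Rightarrow> real^'n"
  where "Y_step F \<beta> x = x - \<beta> *\<^sub>R newton_corr F x"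

definition T_mat :: "(real^'n \<Rightarrow> real^'n) \<Rightarrow> real \<Rightarrow> real^'n \<Rightarrow> real^'n^'n"
  where "T_mat F \<beta> x = matrix_inv (jac F x) ** jac F (Y_step F \<beta> x)"

definition X_step ::
  "(real^'n \<Rightarrow> real^'n) \<Rightarrow> real \<Rightarrow> real \<Rightarrow> real \<Rightarrow> real \<Rightarrow> real^'n \<Rightarrow> real^'n"
  where "X_step F \<beta> a1 a2 a3 x =
    (let T = T_mat F \<beta> x in
     x - (1/2) *\<^sub>R
       (((3 *\<^sub>R mat 1 - T) ** (a1 *\<^sub>R mat 1 + a2 *\<^sub>R T + a3 *\<^sub>R (T ** T))) *v newton_corr F x))"

primrec X_seq ::
  "(real^'n \<Rightarrow> real^'n) \<Rightarrow> real \<Rightarrow> real \<Rightarrow> real \<Rightarrow> real \<Rightarrow> real^'n \<Rightarrow> nat \<Rightarrow> real^'n"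
  where
    "X_seq F \<beta> a1 a2 a3 X0 0 = X0"
  | "X_seq F \<beta> a1 a2 a3 X0 (Suc k) = X_step F \<beta> a1 a2 a3 (X_seq F \<beta> a1 a2 a3 X0 k)"

(* The iteration functions are total in HOL (jacobian and matrix_inv return arbitrary values
   where undefined), so well-definedness of the iterates of a map given on D is a separate
   statement. *)
definition iterates_well_defined ::
  "(real^'n) set \<Rightarrow> (real^'n \<Rightarrow> real^'n) \<Rightarrow> real \<Rightarrow> (nat \<Rightarrow> real^'n) \<Rightarrow> bool"
  where "iterates_well_defined D F \<beta> X \<longleftrightarrow>
    (\<forall>k. X k \<in> D \<and> invertible (jac F (X k)) \<and> Y_step F \<beta> (X k) \<in> D)"

(* Order at least p. *)
definition converges_with_order :: "(nat \<Rightarrow> 'a::real_normed_vector) \<Rightarrow> 'a \<Rightarrow> nat \<Rightarrow> bool"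
  where "converges_with_order X \<alpha> p \<longleftrightarrow>
    X \<longlonglongrightarrow> \<alpha> \<and> (\<exists>C. \<forall>k. norm (X (Suc k) - \<alpha>) \<le> C * norm (X k - \<alpha>) ^ p)"

end

theory Submission
  imports Defs
begin

text \<open>
  Everything is expanded around the current iterate \<open>x\<close> instead of around the root \<open>\<alpha>\<close>. Write
  \<open>e = x - \<alpha>\<close>, let \<open>L\<close> be the inverse of \<open>F' x\<close>, put \<open>u = L (F x)\<close>, and let \<open>b = L F''(x)\<close> and
  \<open>c = L F'''(x)\<close> be the normalised second and third derivatives. Since \<open>x - e = \<alpha>\<close> is a root, the
  Taylor formula for \<open>F\<close> reads \<open>u = e - b(e,e)/2 + c(e,e,e)/6 + O(|e|^4)\<close>. Inverting this relation,
  with the symmetry of \<open>b\<close>, gives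
  \<open>e = u + b(u,u)/2 + b(u,b(u,u))/2 - c(u,u,u)/6 + O(|e|^4)\<close>.

  On the other side put \<open>S = I - T\<close>. With the given parameters the matrix weight is
  \<open>I + (3/4) S + (9/8) S\<^sup>2 + (1/2) S^3\<close>, and the Taylor formula for \<open>F'\<close> at \<open>x\<close>, with displacement
  \<open>-(2/3) u\<close>, gives \<open>S = (2/3) b(u,-) - (2/9) c(u,u,-) + O(|e|^3)\<close>. Hence the correction is
  \<open>u + b(u,u)/2 - c(u,u,u)/6 + b(u,b(u,u))/2 + O(|e|^4)\<close>, because \<open>(9/8) (2/3)\<^sup>2 = 1/2\<close>. It agrees
  with \<open>e\<close> up to \<open>O(|e|^4)\<close>, so one step leaves an error of fourth order; this is
  \<open>weighted_newton_step_error\<close>. The scalar computation survives in higher dimension because all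
  matrix products are powers of the single operator \<open>S\<close> and because \<open>b\<close> is symmetric
  (\<open>second_derivative_symmetric\<close>). Finally \<open>iteration_converges_with_order\<close> turns the estimate for
  one step into convergence: on a small ball each step at least halves the error.
\<close>

section \<open>Order of vanishing at a point\<close>

text \<open>
  The estimate \<open>f x = O(|x - a|^k)\<close> for functions with values in any normed space, so that
  operator-valued remainders are covered as well. The neighbourhood includes \<open>a\<close> itself, so for
  \<open>0 < k\<close> such a function is zero at \<open>a\<close>.
\<close>
definition vanishes_order ::
  "'a::real_normed_vector \<Rightarrow> nat \<Rightarrow> ('a \<Rightarrow> 'b::real_normed_vector) \<Rightarrow> bool"
  where "vanishes_order a k f \<longleftrightarrow>
    (\<exists>C. \<forall>\<^sub>F x in nhds a. norm (f x) \<le> C * norm (x - a) ^ k)"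

lemma vanishes_orderI:
  "\<forall>\<^sub>F x in nhds a. norm (f x) \<le> C * norm (x - a) ^ k \<Longrightarrow> vanishes_order a k f"
  unfolding vanishes_order_def by blast

lemma vanishes_orderE:
  assumes "vanishes_order a k f"
  obtains C where "C \<ge> 0" "\<forall>\<^sub>F x in nhds a. norm (f x) \<le> C * norm (x - a) ^ k"
proof -
  from assms obtain C where C: "\<forall>\<^sub>F x in nhds a. norm (f x) \<le> C * norm (x - a) ^ k"
    unfolding vanishes_order_def by blast
  have "\<forall>\<^sub>F x in nhds a. norm (f x) \<le> \<bar>C\<bar> * norm (x - a) ^ k"
    using C by eventually_elim (smt (verit) mult_right_mono norm_ge_zero zero_le_power)
  then show thesis using that[of "\<bar>C\<bar>"] by simp
qed

lemma vanishes_order_transform: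
  assumes "vanishes_order a k f" "\<forall>\<^sub>F x in nhds a. f x = g x"
  shows "vanishes_order a k g"
proof -
  from assms(1) obtain C where "\<forall>\<^sub>F x in nhds a. norm (f x) \<le> C * norm (x - a) ^ k"
    unfolding vanishes_order_def by blast
  with assms(2) have "\<forall>\<^sub>F x in nhds a. norm (g x) \<le> C * norm (x - a) ^ k"
    by eventually_elim simp
  then show ?thesis by (rule vanishes_orderI)
qed

lemma vanishes_order_add:
  assumes "vanishes_order a k f" "vanishes_order a k g"
  shows "vanishes_order a k (\<lambda>x. f x + g x)"
proof -
  from assms(1) obtain C where C: "\<forall>\<^sub>F x in nhds a. norm (f x) \<le> C * norm (x - a) ^ k"
    unfolding vanishes_order_def by blast
  from assms(2) obtain B where B: "\<forall>\<^sub>F x in nhds a. norm (g x) \<le> B * norm (x - a) ^ k"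
    unfolding vanishes_order_def by blast
  have "\<forall>\<^sub>F x in nhds a. norm (f x + g x) \<le> (C + B) * norm (x - a) ^ k"
    using C B by eventually_elim (smt (verit) norm_triangle_ineq distrib_right)
  then show ?thesis by (rule vanishes_orderI)
qed

lemma vanishes_order_scaleR:
  assumes "vanishes_order a k f"
  shows "vanishes_order a k (\<lambda>x. c *\<^sub>R f x)"
proof -
  from assms obtain C where C: "\<forall>\<^sub>F x in nhds a. norm (f x) \<le> C * norm (x - a) ^ k"
    unfolding vanishes_order_def by blast
  have "\<forall>\<^sub>F x in nhds a. norm (c *\<^sub>R f x) \<le> (\<bar>c\<bar> * C) * norm (x - a) ^ k"
    using C by eventually_elim (simp add: mult_left_mono mult.assoc)
  then show ?thesis by (rule vanishes_orderI)
qed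

lemma vanishes_order_minus:
  "vanishes_order a k f \<Longrightarrow> vanishes_order a k (\<lambda>x. - f x)"
  using vanishes_order_scaleR[of a k f "-1"] by simp

lemma vanishes_order_diff:
  "vanishes_order a k f \<Longrightarrow> vanishes_order a k g \<Longrightarrow> vanishes_order a k (\<lambda>x. f x - g x)"
  using vanishes_order_add[of a k f "\<lambda>x. - g x"] vanishes_order_minus[of a k g] by simp

lemma vanishes_order_mono:
  assumes "vanishes_order a k f" "j \<le> k"
  shows "vanishes_order a j f"
proof -
  from assms(1) obtain C where C0: "C \<ge> 0"
    and C: "\<forall>\<^sub>F x in nhds a. norm (f x) \<le> C * norm (x - a) ^ k"
    by (rule vanishes_orderE)
  have "\<forall>\<^sub>F x in nhds a. dist x a < 1"
    using eventually_nhds_metric zero_less_one by blast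
  with C have "\<forall>\<^sub>F x in nhds a. norm (f x) \<le> C * norm (x - a) ^ j"
  proof eventually_elim
    case (elim x)
    have "norm (x - a) ^ k \<le> norm (x - a) ^ j"
      using elim(2) assms(2) by (intro power_decreasing) (auto simp: dist_norm)
    then show ?case using elim(1) C0 by (meson mult_left_mono order_trans)
  qed
  then show ?thesis by (rule vanishes_orderI)
qed

text \<open>
  Multilinear maps are iterated applications of bounded linear functions, so this single rule
  computes the order of every term of a Taylor expansion.
\<close>
lemma vanishes_order_blinfun_apply:
  assumes "vanishes_order a i A" "vanishes_order a j f" "i + j = k"
  shows "vanishes_order a k (\<lambda>x. blinfun_apply (A x) (f x))"
proof -
  from assms(1) obtain C where C0: "C \<ge> 0"
    and C: "\<forall>\<^sub>F x in nhds a. norm (A x) \<le> C * norm (x - a) ^ i"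
    by (rule vanishes_orderE)
  from assms(2) obtain B where B0: "B \<ge> 0"
    and B: "\<forall>\<^sub>F x in nhds a. norm (f x) \<le> B * norm (x - a) ^ j"
    by (rule vanishes_orderE)
  have "\<forall>\<^sub>F x in nhds a. norm (A x (f x)) \<le> (C * B) * norm (x - a) ^ k"
    using C B
  proof eventually_elim
    case (elim x)
    have "norm (A x (f x)) \<le> norm (A x) * norm (f x)" by (rule norm_blinfun)
    also have "\<dots> \<le> (C * norm (x - a) ^ i) * (B * norm (x - a) ^ j)"
      using elim C0 by (intro mult_mono) auto
    also have "\<dots> = (C * B) * norm (x - a) ^ k"
      by (simp flip: assms(3) add: power_add)
    finally show ?case .
  qed
  then show ?thesis by (rule vanishes_orderI)
qed

lemma vanishes_order_isCont:
  assumes "isCont f a"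
  shows "vanishes_order a 0 f"
proof -
  have "\<forall>\<^sub>F x in nhds a. dist (f x) (f a) < 1"
    by (metis assms isCont_def tendsto_at_iff_tendsto_nhds tendstoD zero_less_one)
  then have "\<forall>\<^sub>F x in nhds a. norm (f x) \<le> (norm (f a) + 1) * norm (x - a) ^ 0"
    by eventually_elim (simp add: dist_norm, smt (verit) norm_triangle_sub)
  then show ?thesis by (rule vanishes_orderI)
qed

lemma vanishes_order_displacement: "vanishes_order a 1 (\<lambda>x. x - a)"
  by (rule vanishes_orderI[where C = 1]) simp

lemma vanishes_order_tendsto:
  assumes "vanishes_order a k f" "0 < k"
  shows "(f \<longlongrightarrow> 0) (nhds a)"
proof -
  from assms(1) obtain C where "\<forall>\<^sub>F x in nhds a. norm (f x) \<le> C * norm (x - a) ^ k"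
    by (rule vanishes_orderE)
  moreover have "((\<lambda>x. C * norm (x - a) ^ k) \<longlongrightarrow> C * norm (a - a) ^ k) (nhds a)"
    by (intro tendsto_intros filterlim_ident)
  ultimately show ?thesis
    using assms(2) by (intro Lim_null_comparison[of f]) (auto simp: power_0_left)
qed

lemma vanishes_order_eventually_near:
  assumes "vanishes_order a 1 (\<lambda>x. h x)" "open U" "a \<in> U"
  shows "\<forall>\<^sub>F x in nhds a. x + h x \<in> U"
proof -
  have "((\<lambda>x. x + h x) \<longlongrightarrow> a + 0) (nhds a)"
    by (intro tendsto_add vanishes_order_tendsto[OF assms(1)] filterlim_ident) simp
  then show ?thesis using topological_tendstoD assms(2,3) by fastforce
qed

section \<open>Taylor expansion with uniform remainder\<close>

text \<open>
  The kernel \<open>(1 - t)^(p - 1) / (p - 1)!\<close> of the integral remainder is at most one on the unit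
  interval.
\<close>
lemma Taylor_bound_unit_interval:
  fixes Df :: "nat \<Rightarrow> real \<Rightarrow> 'a::banach"
  assumes p: "0 < p"
    and Df: "\<And>m t. m < p \<Longrightarrow> 0 \<le> t \<Longrightarrow> t \<le> 1 \<Longrightarrow>
      (Df m has_vector_derivative Df (Suc m) t) (at t within {0..1})"
    and M: "\<And>t. 0 \<le> t \<Longrightarrow> t \<le> 1 \<Longrightarrow> norm (Df p t) \<le> M"
  shows "norm (Df 0 1 - (\<Sum>i<p. (1 / fact i) *\<^sub>R Df i 0)) \<le> M"
proof -
  have M0: "0 \<le> M" using M[of 0] norm_ge_zero[of "Df p 0"] by linarith
  have I: "((\<lambda>t. ((1 - t) ^ (p - 1) / fact (p - 1)) *\<^sub>R Df p t) has_integral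
      Df 0 1 - (\<Sum>i<p. ((1 - 0) ^ i / fact i) *\<^sub>R Df i 0)) {0..1}"
    by (rule Taylor_has_integral) (use p Df in auto)
  have "norm (((1 - t) ^ (p - 1) / fact (p - 1)) *\<^sub>R Df p t) \<le> M" if "t \<in> {0..1}" for t :: real
  proof -
    have "(1 - t) ^ (p - 1) \<le> 1" "0 \<le> (1 - t) ^ (p - 1)"
      using that by (auto simp: power_le_one)
    moreover have "(1::real) \<le> fact (p - 1)" by (rule fact_ge_1)
    ultimately have "0 \<le> (1 - t) ^ (p - 1)" "(1 - t) ^ (p - 1) \<le> fact (p - 1)" by linarith+
    then have "\<bar>(1 - t) ^ (p - 1) / fact (p - 1)\<bar> \<le> 1"
      by (simp only: abs_of_nonneg divide_nonneg_nonneg fact_ge_zero divide_le_eq_1) simp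
    then have "norm (((1 - t) ^ (p - 1) / fact (p - 1)) *\<^sub>R Df p t) \<le> 1 * M"
      unfolding norm_scaleR using M[of t] that by (intro mult_mono) auto
    then show ?thesis by simp
  qed
  from has_integral_bound_real[OF M0 finite.emptyI I] this show ?thesis by simp
qed

lemma has_vector_derivative_along_line:
  assumes "frechet_derivative_on D G G'" "x + t *\<^sub>R h \<in> D"
  shows "((\<lambda>s. G (x + s *\<^sub>R h)) has_vector_derivative G' (x + t *\<^sub>R h) h) (at t within S)"
proof -
  have G: "(G has_derivative blinfun_apply (G' (x + t *\<^sub>R h))) (at (x + t *\<^sub>R h))"
    using assms unfolding frechet_derivative_on_def by blast
  have "((\<lambda>s. x + s *\<^sub>R h) has_derivative (\<lambda>s. s *\<^sub>R h)) (at t)"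
    by (auto intro!: derivative_eq_intros)
  from has_derivative_compose[OF this G]
  have "((\<lambda>s. G (x + s *\<^sub>R h)) has_vector_derivative G' (x + t *\<^sub>R h) h) (at t)"
    by (simp add: has_vector_derivative_def blinfun.scaleR_right)
  then show ?thesis by (rule has_vector_derivative_at_within)
qed

lemma has_vector_derivative_blinfun_apply_left:
  assumes "(A has_vector_derivative A') F"
  shows "((\<lambda>s. blinfun_apply (A s) h) has_vector_derivative blinfun_apply A' h) F"
  using bounded_linear.has_vector_derivative[OF blinfun.bounded_linear_left assms] .

lemma norm_blinfun_le:
  "norm A \<le> c \<Longrightarrow> norm (blinfun_apply A h) \<le> c * norm h"
  by (meson mult_right_mono norm_blinfun norm_ge_zero order_trans)

text \<open>
  The iterated Frechet derivatives live in types that depend on their order. What Taylor's formula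
  needs is only the path \<open>t \<mapsto> Df m (x + t h) h\<close>, where \<open>Df m x h\<close> stands for the \<open>m\<close>-th
  derivative at \<open>x\<close> applied to \<open>m\<close> copies of \<open>h\<close>, and these values all have the type of \<open>Df 0 x h\<close>.
  The base point \<open>x\<close> of the expansion moves, so the bound on \<open>Df p\<close> must be uniform near \<open>a\<close>.
\<close>
lemma vanishes_order_Taylor:
  fixes Df :: "nat \<Rightarrow> 'a::real_normed_vector \<Rightarrow> 'a \<Rightarrow> 'b::banach"
  assumes D: "open D" "a \<in> D" and p: "0 < p"
    and Df: "\<And>m x t h. m < p \<Longrightarrow> x + t *\<^sub>R h \<in> D \<Longrightarrow>
      ((\<lambda>s. Df m (x + s *\<^sub>R h) h) has_vector_derivative Df (Suc m) (x + t *\<^sub>R h) h)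
        (at t within {0..1})"
    and bdd: "\<forall>\<^sub>F x in nhds a. \<forall>h. norm (Df p x h) \<le> M * norm h ^ p"
    and h: "vanishes_order a 1 h"
  shows "vanishes_order a p
    (\<lambda>x. Df 0 (x + h x) (h x) - (\<Sum>i<p. (1 / fact i) *\<^sub>R Df i x (h x)))"
proof -
  obtain C where C: "C \<ge> 0" "\<forall>\<^sub>F x in nhds a. norm (h x) \<le> C * norm (x - a) ^ 1"
    using h by (rule vanishes_orderE)
  have "\<forall>\<^sub>F x in nhds a. (\<forall>h. norm (Df p x h) \<le> M * norm h ^ p) \<and> x \<in> D"
    using bdd eventually_nhds_in_open[OF D] by eventually_elim simp
  then obtain r where r: "r > 0"
    "\<And>x. x \<in> ball a r \<Longrightarrow> (\<forall>h. norm (Df p x h) \<le> M * norm h ^ p) \<and> x \<in> D"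
    unfolding eventually_nhds_metric by (metis dist_commute mem_ball)
  have "\<forall>\<^sub>F x in nhds a. x \<in> ball a r"
    using r(1) by (intro eventually_nhds_in_open) auto
  moreover have "\<forall>\<^sub>F x in nhds a. x + h x \<in> ball a r"
    using r(1) by (intro vanishes_order_eventually_near[OF h]) auto
  ultimately have "\<forall>\<^sub>F x in nhds a.
    norm (Df 0 (x + h x) (h x) - (\<Sum>i<p. (1 / fact i) *\<^sub>R Df i x (h x)))
      \<le> (\<bar>M\<bar> * C ^ p) * norm (x - a) ^ p"
    using C(2)
  proof eventually_elim
    case (elim x)
    have seg: "x + t *\<^sub>R h x \<in> ball a r" if "0 \<le> t" "t \<le> 1" for t
    proof -
      have "(1 - t) *\<^sub>R x + t *\<^sub>R (x + h x) \<in> ball a r"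
        using elim(1,2) that by (intro convexD_alt[OF convex_ball]) auto
      then show ?thesis by (simp add: algebra_simps)
    qed
    have "norm (Df 0 (x + 1 *\<^sub>R h x) (h x)
        - (\<Sum>i<p. (1 / fact i) *\<^sub>R Df i (x + 0 *\<^sub>R h x) (h x))) \<le> M * norm (h x) ^ p"
      by (rule Taylor_bound_unit_interval[where Df = "\<lambda>m t. Df m (x + t *\<^sub>R h x) (h x)"])
        (use p Df r(2) seg in auto)
    also have "\<dots> \<le> \<bar>M\<bar> * norm (h x) ^ p"
      by (intro mult_right_mono) auto
    also have "\<dots> \<le> \<bar>M\<bar> * (C * norm (x - a)) ^ p"
      using elim(3) by (intro mult_left_mono power_mono) auto
    finally show ?case by (simp add: power_mult_distrib mult.assoc)
  qed
  then show ?thesis by (rule vanishes_orderI)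
qed

lemma vanishes_order_Taylor3:
  fixes G :: "'a::real_normed_vector \<Rightarrow> 'b::banach"
  assumes D: "open D" "a \<in> D"
    and G: "frechet_derivative_on D G G1" "frechet_derivative_on D G1 G2"
      "frechet_derivative_on D G2 G3"
    and bdd: "vanishes_order a 0 G3"
    and h: "vanishes_order a 1 h"
  shows "vanishes_order a 3
    (\<lambda>x. G (x + h x) - (G x + G1 x (h x) + (1/2) *\<^sub>R G2 x (h x) (h x)))"
proof -
  define Df where "Df m x h = [G x, G1 x h, G2 x h h, G3 x h h h] ! m" for m x h
  obtain M where "\<forall>\<^sub>F x in nhds a. norm (G3 x) \<le> M * norm (x - a) ^ 0"
    using bdd by (rule vanishes_orderE)
  then have bound: "\<forall>\<^sub>F x in nhds a. \<forall>h. norm (Df 3 x h) \<le> M * norm h ^ 3"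
  proof eventually_elim
    case (elim x)
    have "norm (G3 x h h h) \<le> M * norm h * norm h * norm h" for h
      using elim by (intro norm_blinfun_le) simp
    then show ?case by (simp add: Df_def power3_eq_cube mult.assoc)
  qed
  have "vanishes_order a 3 (\<lambda>x. Df 0 (x + h x) (h x) - (\<Sum>i<3. (1 / fact i) *\<^sub>R Df i x (h x)))"
  proof (rule vanishes_order_Taylor[where D = D and Df = Df and M = M and p = 3, OF D _ _ bound h])
    fix m x t h assume m: "m < (3::nat)" and inD: "x + t *\<^sub>R h \<in> D"
    note lines = has_vector_derivative_along_line[OF _ inD]
    from m consider "m = 0" | "m = 1" | "m = 2" by linarith
    then show "((\<lambda>s. Df m (x + s *\<^sub>R h) h) has_vector_derivative Df (Suc m) (x + t *\<^sub>R h) h)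
        (at t within {0..1})"
      by cases (auto simp: Df_def intro!: has_vector_derivative_blinfun_apply_left
          lines[OF G(1)] lines[OF G(2)] lines[OF G(3)])
  qed simp
  then show ?thesis by (simp add: Df_def eval_nat_numeral add.assoc)
qed

lemma vanishes_order_Taylor4:
  fixes G :: "'a::real_normed_vector \<Rightarrow> 'b::banach"
  assumes D: "open D" "a \<in> D"
    and G: "frechet_derivative_on D G G1" "frechet_derivative_on D G1 G2"
      "frechet_derivative_on D G2 G3" "frechet_derivative_on D G3 G4"
    and bdd: "vanishes_order a 0 G4"
    and h: "vanishes_order a 1 h"
  shows "vanishes_order a 4
    (\<lambda>x. G (x + h x) - (G x + G1 x (h x) + (1/2) *\<^sub>R G2 x (h x) (h x)
      + (1/6) *\<^sub>R G3 x (h x) (h x) (h x)))"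
proof -
  define Df where "Df m x h = [G x, G1 x h, G2 x h h, G3 x h h h, G4 x h h h h] ! m" for m x h
  obtain M where "\<forall>\<^sub>F x in nhds a. norm (G4 x) \<le> M * norm (x - a) ^ 0"
    using bdd by (rule vanishes_orderE)
  then have bound: "\<forall>\<^sub>F x in nhds a. \<forall>h. norm (Df 4 x h) \<le> M * norm h ^ 4"
  proof eventually_elim
    case (elim x)
    have "norm (G4 x h h h h) \<le> M * norm h * norm h * norm h * norm h" for h
      using elim by (intro norm_blinfun_le) simp
    then show ?case by (simp add: Df_def power4_eq_xxxx mult.assoc)
  qed
  have "vanishes_order a 4 (\<lambda>x. Df 0 (x + h x) (h x) - (\<Sum>i<4. (1 / fact i) *\<^sub>R Df i x (h x)))"
  proof (rule vanishes_order_Taylor[where D = D and Df = Df and M = M and p = 4, OF D _ _ bound h])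
    fix m x t h assume m: "m < (4::nat)" and inD: "x + t *\<^sub>R h \<in> D"
    note lines = has_vector_derivative_along_line[OF _ inD]
    from m consider "m = 0" | "m = 1" | "m = 2" | "m = 3" by linarith
    then show "((\<lambda>s. Df m (x + s *\<^sub>R h) h) has_vector_derivative Df (Suc m) (x + t *\<^sub>R h) h)
        (at t within {0..1})"
      by cases (auto simp: Df_def intro!: has_vector_derivative_blinfun_apply_left
          lines[OF G(1)] lines[OF G(2)] lines[OF G(3)] lines[OF G(4)])
  qed simp
  then show ?thesis by (simp add: Df_def eval_nat_numeral add.assoc)
qed


section \<open>Symmetry of the second derivative\<close>

text \<open>
  The second difference is the increment over \<open>[0,1]\<close> of \<open>t \<mapsto> G (a + h + t k) - G (a + t k)\<close>, whose
  derivative is \<open>(G1 (a + h + t k) - G1 (a + t k)) k\<close>. Both values of \<open>G1\<close> are replaced by their affine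
  approximation at \<open>a\<close>; what remains is \<open>B h k\<close>.
\<close>
lemma second_difference_approximates_second_derivative:
  fixes G :: "'a::real_normed_vector \<Rightarrow> 'b::banach"
  assumes D: "open D" "a \<in> D" and G: "frechet_derivative_on D G G1"
    and G1: "(G1 has_derivative blinfun_apply B) (at a)" and "0 < \<epsilon>"
  obtains \<delta> where "0 < \<delta>" "\<And>h k. norm h < \<delta> \<Longrightarrow> norm k < \<delta> \<Longrightarrow>
    norm (G (a + h + k) - G (a + h) - G (a + k) + G a - B h k)
      \<le> \<epsilon> * ((norm h + 2 * norm k) * norm k)"
proof -
  obtain d where d: "0 < d"
    "\<And>y. norm (y - a) < d \<Longrightarrow> norm (G1 y - G1 a - B (y - a)) \<le> \<epsilon> * norm (y - a)"
    using G1 \<open>0 < \<epsilon>\<close> unfolding has_derivative_at_alt by blast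
  obtain r where r: "0 < r" "ball a r \<subseteq> D" using D by (meson open_contains_ball)
  define \<delta> where "\<delta> = min d r / 2"
  have "0 < \<delta>" using d r by (simp add: \<delta>_def)
  moreover have "norm (G (a + h + k) - G (a + h) - G (a + k) + G a - B h k)
      \<le> \<epsilon> * ((norm h + 2 * norm k) * norm k)" if hk: "norm h < \<delta>" "norm k < \<delta>" for h k
  proof -
    define Df :: "nat \<Rightarrow> real \<Rightarrow> 'b" where "Df m t =
      [G (a + h + t *\<^sub>R k) - G (a + t *\<^sub>R k) - t *\<^sub>R B h k,
       G1 (a + h + t *\<^sub>R k) k - G1 (a + t *\<^sub>R k) k - B h k] ! m" for m t
    have "norm (Df 0 1 - (\<Sum>i<1. (1 / fact i) *\<^sub>R Df i 0))
      \<le> \<epsilon> * (norm h + 2 * norm k) * norm k"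
    proof (rule Taylor_bound_unit_interval)
      fix t :: real assume t: "0 \<le> t" "t \<le> 1"
      have tk: "norm (t *\<^sub>R k) \<le> norm k" using t by (simp add: mult_left_le_one_le)
      have htk: "norm (h + t *\<^sub>R k) \<le> norm h + norm k"
        using norm_triangle_ineq[of h "t *\<^sub>R k"] tk by linarith
      have small: "norm (h + t *\<^sub>R k) < min d r" "norm (t *\<^sub>R k) < min d r"
        using tk htk hk d(1) r(1) by (auto simp: \<delta>_def)
      have inD: "a + h + t *\<^sub>R k \<in> D" "a + t *\<^sub>R k \<in> D"
        using small r(2) by (auto simp: dist_norm add.assoc subset_iff norm_minus_commute)
      show "(Df m has_vector_derivative Df (Suc m) t) (at t within {0..1})" if "m < 1" for m
      proof -
        have "((\<lambda>s. s *\<^sub>R B h k) has_vector_derivative B h k) (at t within {0..1})"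
          by (auto simp: has_vector_derivative_def intro!: derivative_eq_intros)
        from has_vector_derivative_diff[OF has_vector_derivative_diff[OF
            has_vector_derivative_along_line[OF G inD(1)]
            has_vector_derivative_along_line[OF G inD(2)]] this]
        show ?thesis using that by (simp add: Df_def[abs_def])
      qed
      have "norm (G1 (a + h + t *\<^sub>R k) - G1 a - B (h + t *\<^sub>R k)) \<le> \<epsilon> * norm (h + t *\<^sub>R k)"
        using d(2)[of "a + h + t *\<^sub>R k"] small by (simp add: algebra_simps)
      also have "\<dots> \<le> \<epsilon> * (norm h + norm k)" using htk \<open>0 < \<epsilon>\<close> by simp
      finally have 1: "norm (G1 (a + h + t *\<^sub>R k) - G1 a - B (h + t *\<^sub>R k))
        \<le> \<epsilon> * (norm h + norm k)" .
      have "norm (G1 (a + t *\<^sub>R k) - G1 a - B (t *\<^sub>R k)) \<le> \<epsilon> * norm (t *\<^sub>R k)"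
        using d(2)[of "a + t *\<^sub>R k"] small by simp
      also have "\<dots> \<le> \<epsilon> * norm k" using tk \<open>0 < \<epsilon>\<close> by simp
      finally have 2: "norm (G1 (a + t *\<^sub>R k) - G1 a - B (t *\<^sub>R k)) \<le> \<epsilon> * norm k" .
      let ?A = "G1 (a + h + t *\<^sub>R k) - G1 (a + t *\<^sub>R k) - B h"
      have "?A = (G1 (a + h + t *\<^sub>R k) - G1 a - B (h + t *\<^sub>R k))
        - (G1 (a + t *\<^sub>R k) - G1 a - B (t *\<^sub>R k))"
        by (simp add: blinfun.add_right)
      then have "norm ?A \<le> \<epsilon> * (norm h + 2 * norm k)"
        using norm_triangle_ineq4[of "G1 (a + h + t *\<^sub>R k) - G1 a - B (h + t *\<^sub>R k)"
            "G1 (a + t *\<^sub>R k) - G1 a - B (t *\<^sub>R k)"] 1 2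
        by (simp only:) (simp add: algebra_simps)
      from norm_blinfun_le[OF this, of k]
      show "norm (Df 1 t) \<le> \<epsilon> * (norm h + 2 * norm k) * norm k"
        by (simp add: Df_def blinfun.diff_left)
    qed simp
    then show ?thesis by (simp add: Df_def algebra_simps)
  qed
  ultimately show thesis by (rule that)
qed

text \<open>
  The second difference is symmetric in \<open>h\<close> and \<open>k\<close>. Replacing them by \<open>t h\<close> and \<open>t k\<close> multiplies both
  the derivative terms and the error bound by \<open>t\<^sup>2\<close>, so the smallness condition costs nothing and
  the norm of \<open>B h k - B k h\<close> is at most every positive multiple of a fixed constant.
\<close>
lemma second_derivative_symmetric:
  fixes G :: "'a::real_normed_vector \<Rightarrow> 'b::banach"
  assumes D: "open D" "a \<in> D" and G: "frechet_derivative_on D G G1"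
    and G1: "(G1 has_derivative blinfun_apply B) (at a)"
  shows "B h k = B k h"
proof -
  define c where "c = (norm h + 2 * norm k) * norm k + (norm k + 2 * norm h) * norm h"
  have c: "0 \<le> c" by (simp add: c_def)
  have bound: "norm (B h k - B k h) \<le> \<epsilon> * c" if "0 < \<epsilon>" for \<epsilon>
  proof -
    obtain \<delta> where \<delta>: "0 < \<delta>" "\<And>h k. norm h < \<delta> \<Longrightarrow> norm k < \<delta> \<Longrightarrow>
      norm (G (a + h + k) - G (a + h) - G (a + k) + G a - B h k)
        \<le> \<epsilon> * ((norm h + 2 * norm k) * norm k)"
      by (rule second_difference_approximates_second_derivative[OF D G G1 \<open>0 < \<epsilon>\<close>]) blast
    define t where "t = \<delta> / (norm h + norm k + 1)"
    have t: "0 < t" using \<delta>(1) by (auto simp: t_def intro!: divide_pos_pos add_nonneg_pos)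
    have "t * (norm h + norm k + 1) = \<delta>"
      using norm_ge_zero[of h] norm_ge_zero[of k] by (simp add: t_def add_nonneg_eq_0_iff)
    then have "t * norm h + t * norm k + t = \<delta>" by (simp add: algebra_simps)
    moreover have "0 \<le> t * norm h" "0 \<le> t * norm k" using t by auto
    ultimately have small: "norm (t *\<^sub>R h) < \<delta>" "norm (t *\<^sub>R k) < \<delta>"
      unfolding norm_scaleR abs_of_pos[OF t] using t by linarith+
    define \<Delta> where "\<Delta> = G (a + t *\<^sub>R h + t *\<^sub>R k) - G (a + t *\<^sub>R h) - G (a + t *\<^sub>R k) + G a"
    have 1: "norm (\<Delta> - t\<^sup>2 *\<^sub>R B h k) \<le> t\<^sup>2 * (\<epsilon> * ((norm h + 2 * norm k) * norm k))"
      using \<delta>(2)[OF small] t unfolding \<Delta>_def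
      by (simp add: blinfun.scaleR_right blinfun.scaleR_left power2_eq_square algebra_simps)
    have 2: "norm (\<Delta> - t\<^sup>2 *\<^sub>R B k h) \<le> t\<^sup>2 * (\<epsilon> * ((norm k + 2 * norm h) * norm h))"
      using \<delta>(2)[OF small(2,1)] t unfolding \<Delta>_def
      by (simp add: blinfun.scaleR_right blinfun.scaleR_left power2_eq_square algebra_simps)
    have "t\<^sup>2 * norm (B h k - B k h) = norm (t\<^sup>2 *\<^sub>R (B h k - B k h))" by simp
    also have "t\<^sup>2 *\<^sub>R (B h k - B k h) = (\<Delta> - t\<^sup>2 *\<^sub>R B k h) - (\<Delta> - t\<^sup>2 *\<^sub>R B h k)"
      by (simp add: algebra_simps)
    also have "norm \<dots> \<le> t\<^sup>2 * (\<epsilon> * c)"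
      using norm_triangle_ineq4[of "\<Delta> - t\<^sup>2 *\<^sub>R B k h" "\<Delta> - t\<^sup>2 *\<^sub>R B h k"] 1 2
      unfolding c_def by (simp only: distrib_left)
    finally show ?thesis using t by simp
  qed
  have "norm (B h k - B k h) = 0"
  proof (rule ccontr)
    assume "norm (B h k - B k h) \<noteq> 0"
    then have pos: "0 < norm (B h k - B k h)" by simp
    have "norm (B h k - B k h) \<le> norm (B h k - B k h) / (c + 1) * c"
      using pos c by (intro bound divide_pos_pos) auto
    also have "\<dots> < norm (B h k - B k h)"
      using pos c by (simp add: field_simps)
    finally show False by simp
  qed
  then show ?thesis by simp
qed

section \<open>One step of the iteration\<close>

lemma frechet_derivative_on_isCont:
  "frechet_derivative_on D f f' \<Longrightarrow> x \<in> D \<Longrightarrow> isCont f x"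
  unfolding frechet_derivative_on_def by (blast intro: has_derivative_continuous)

text \<open>
  A perturbation argument: for \<open>v = L x w\<close> one has \<open>v = L a (w - (A x - A a) v)\<close>, and for \<open>x\<close> near \<open>a\<close>
  the term with \<open>v\<close> on the right has at most half the norm of \<open>v\<close> and can be absorbed.
\<close>
lemma inverse_derivative_locally_bounded:
  fixes A :: "'a::real_normed_vector \<Rightarrow> 'b::real_normed_vector \<Rightarrow>\<^sub>L 'c::real_normed_vector"
    and L :: "'a \<Rightarrow> 'c \<Rightarrow>\<^sub>L 'b"
  assumes A: "isCont A a"
    and inv: "\<forall>\<^sub>F x in nhds a. \<forall>w. A x (L x w) = w" and inv_a: "\<And>v. L a (A a v) = v"
  shows "vanishes_order a 0 L"
proof -
  define K where "K = norm (L a) + 1"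
  have K: "0 < K" by (simp add: K_def add_nonneg_pos)
  have "\<forall>\<^sub>F x in nhds a. dist (A x) (A a) < 1 / (2 * K)"
    using A K by (intro tendstoD) (auto simp: isCont_def tendsto_at_iff_tendsto_nhds)
  with inv have "\<forall>\<^sub>F x in nhds a. norm (L x) \<le> (2 * K) * norm (x - a) ^ 0"
  proof eventually_elim
    case (elim x)
    have "norm (L x w) \<le> 2 * K * norm w" for w
    proof -
      let ?v = "L x w"
      have "norm ?v = norm (L a (A a ?v))" by (simp add: inv_a)
      also have "\<dots> \<le> K * norm (A a ?v)" by (rule norm_blinfun_le) (simp add: K_def)
      also have "A a ?v = w - (A x - A a) ?v" using elim(1) by (simp add: blinfun.diff_left)
      also have "norm \<dots> \<le> norm w + norm ((A x - A a) ?v)" by (rule norm_triangle_ineq4)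
      also have "norm ((A x - A a) ?v) \<le> 1 / (2 * K) * norm ?v"
        using elim(2) by (intro norm_blinfun_le) (simp add: dist_norm)
      finally have "norm ?v \<le> K * (norm w + 1 / (2 * K) * norm ?v)" using K by simp
      then show ?thesis using K by (simp add: field_simps)
    qed
    then show ?case using K by (simp add: norm_blinfun_bound)
  qed
  then show ?thesis by (rule vanishes_orderI)
qed

lemmas vanishes_order_combine =
  vanishes_order_add vanishes_order_diff vanishes_order_scaleR

text \<open>
  The heart of the proof: the relation between \<open>e\<close> and \<open>u\<close>, and the expansion of the operator \<open>S\<close>, are
  compared up to fourth order. The operator \<open>S x\<close> is \<open>I - T\<close>, with \<open>I\<close> written as \<open>L x\<close> after \<open>F1 x\<close>,
  so that only a difference of values of \<open>F1\<close> has to be expanded.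
\<close>
lemma weighted_newton_step_error:
  fixes F :: "'a::real_normed_vector \<Rightarrow> 'b::banach" and L :: "'a \<Rightarrow> 'b \<Rightarrow>\<^sub>L 'a"
  assumes D: "open D" "\<alpha> \<in> D" and zero: "F \<alpha> = 0"
    and F: "frechet_derivative_on D F F1" "frechet_derivative_on D F1 F2"
      "frechet_derivative_on D F2 F3" "frechet_derivative_on D F3 F4"
    and F4: "isCont F4 \<alpha>"
    and L: "vanishes_order \<alpha> 0 L" and inv: "\<forall>x\<in>D. \<forall>v. L x (F1 x v) = v"
  defines "u \<equiv> \<lambda>x. L x (F x)"
  defines "S \<equiv> \<lambda>x v. L x ((F1 x - F1 (x - (2/3) *\<^sub>R u x)) v)"
  shows "vanishes_order \<alpha> 1 u"
    and "vanishes_order \<alpha> 4 (\<lambda>x. x - (u x + (3/4) *\<^sub>R S x (u x)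
      + (9/8) *\<^sub>R S x (S x (u x)) + (1/2) *\<^sub>R S x (S x (S x (u x)))) - \<alpha>)"
proof -
  note apply_rule = vanishes_order_blinfun_apply
  note combine = vanishes_order_combine
  define e where "e x = x - \<alpha>" for x
  define b where "b x h k = L x (F2 x h k)" for x h k
  define c where "c x h k l = L x (F3 x h k l)" for x h k l
  note inD = eventually_nhds_in_open[OF D]
  note cont = frechet_derivative_on_isCont[OF _ D(2)]
  have F2: "vanishes_order \<alpha> 0 F2" and F3: "vanishes_order \<alpha> 0 F3" and F4': "vanishes_order \<alpha> 0 F4"
    using cont[OF F(3)] cont[OF F(4)] F4 by (auto intro: vanishes_order_isCont)
  have b: "vanishes_order \<alpha> n (\<lambda>x. b x (f x) (g x))"
    if "vanishes_order \<alpha> i f" "vanishes_order \<alpha> j g" "n = i + j" for f g i j n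
    unfolding b_def using that by (auto intro!: apply_rule[OF L apply_rule[OF apply_rule[OF F2]]])
  have c: "vanishes_order \<alpha> n (\<lambda>x. c x (f x) (g x) (h x))"
    if "vanishes_order \<alpha> i f" "vanishes_order \<alpha> j g" "vanishes_order \<alpha> k h" "n = i + j + k"
    for f g h i j k n
    unfolding c_def using that
    by (auto intro!: apply_rule[OF L apply_rule[OF apply_rule[OF apply_rule[OF F3]]]])
  note b_simps = b_def blinfun.add_left blinfun.add_right blinfun.diff_left blinfun.diff_right
  have b_sym: "\<forall>\<^sub>F x in nhds \<alpha>. \<forall>h k. b x h k = b x k h"
    using inD
  proof eventually_elim
    case (elim x)
    have "F2 x h k = F2 x k h" for h k
      using second_derivative_symmetric[OF D(1) elim F(1), of "F2 x"] F(2) elim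
      unfolding frechet_derivative_on_def by blast
    then show ?case by (simp add: b_def)
  qed
  have e: "vanishes_order \<alpha> 1 e"
    using vanishes_order_displacement unfolding e_def .

  \<comment> \<open>Taylor's formula for \<open>F\<close> at \<open>x\<close> with displacement \<open>-e\<close>, which leads to the root\<close>
  define rem_u where "rem_u x = u x - e x + (1/2) *\<^sub>R b x (e x) (e x)
    - (1/6) *\<^sub>R c x (e x) (e x) (e x)" for x
  have rem_u: "vanishes_order \<alpha> 4 rem_u"
  proof -
    have "vanishes_order \<alpha> 4 (\<lambda>x. F (x + - e x) - (F x + F1 x (- e x)
      + (1/2) *\<^sub>R F2 x (- e x) (- e x) + (1/6) *\<^sub>R F3 x (- e x) (- e x) (- e x)))"
      by (rule vanishes_order_Taylor4[OF D F F4' vanishes_order_minus[OF e]])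
    from vanishes_order_minus[OF apply_rule[OF L this, of 4]]
    have "vanishes_order \<alpha> 4 (\<lambda>x. - L x (F (x + - e x) - (F x + F1 x (- e x)
      + (1/2) *\<^sub>R F2 x (- e x) (- e x) + (1/6) *\<^sub>R F3 x (- e x) (- e x) (- e x))))" by simp
    moreover have "\<forall>\<^sub>F x in nhds \<alpha>. - L x (F (x + - e x) - (F x + F1 x (- e x)
      + (1/2) *\<^sub>R F2 x (- e x) (- e x) + (1/6) *\<^sub>R F3 x (- e x) (- e x) (- e x))) = rem_u x"
      using inD
    proof eventually_elim
      case (elim x)
      have "x + - e x = \<alpha>" by (simp add: e_def)
      then show ?case
        by (simp add: rem_u_def zero u_def b_def c_def blinfun.minus_right blinfun.minus_left
          blinfun.add_right blinfun.diff_right blinfun.scaleR_right inv elim)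
    qed
    ultimately show ?thesis by (rule vanishes_order_transform)
  qed
  have bee: "vanishes_order \<alpha> 2 (\<lambda>x. b x (e x) (e x))" by (rule b[OF e e]) simp
  have ceee: "vanishes_order \<alpha> 3 (\<lambda>x. c x (e x) (e x) (e x))" by (rule c[OF e e e]) simp
  define d where "d x = e x - u x" for x
  have d: "vanishes_order \<alpha> 2 d"
  proof -
    have "vanishes_order \<alpha> 2 (\<lambda>x. (1/2) *\<^sub>R b x (e x) (e x)
      - (1/6) *\<^sub>R c x (e x) (e x) (e x) - rem_u x)"
      by (intro combine bee vanishes_order_mono[OF ceee] vanishes_order_mono[OF rem_u]) auto
    then show ?thesis unfolding rem_u_def d_def by (simp add: algebra_simps)
  qed
  have u: "vanishes_order \<alpha> 1 u"
  proof -
    have "vanishes_order \<alpha> 1 (\<lambda>x. e x - d x)"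
      by (intro combine e vanishes_order_mono[OF d]) auto
    then show ?thesis by (simp add: d_def)
  qed
  then show "vanishes_order \<alpha> 1 u" .
  have buu: "vanishes_order \<alpha> 2 (\<lambda>x. b x (u x) (u x))" by (rule b[OF u u]) simp
  \<comment> \<open>First inversion: \<open>e = u + b(u,u)/2\<close> up to third order\<close>
  define q where "q x = d x - (1/2) *\<^sub>R b x (u x) (u x)" for x
  have q: "vanishes_order \<alpha> 3 q"
  proof -
    have "vanishes_order \<alpha> 3 (\<lambda>x. (1/2) *\<^sub>R (b x (d x) (e x) + b x (u x) (d x))
      - (1/6) *\<^sub>R c x (e x) (e x) (e x) - rem_u x)"
      by (intro combine ceee vanishes_order_mono[OF rem_u] b[OF d e] b[OF u d]) auto
    moreover have "(1/2) *\<^sub>R (b x (d x) (e x) + b x (u x) (d x))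
      - (1/6) *\<^sub>R c x (e x) (e x) (e x) - rem_u x = q x" for x
    proof -
      have "b x (d x) (e x) + b x (u x) (d x) = b x (e x) (e x) - b x (u x) (u x)"
        by (simp add: d_def b_simps)
      then show ?thesis
        unfolding \<open>b x (d x) (e x) + b x (u x) (d x) = _\<close>
        by (simp add: q_def rem_u_def d_def algebra_simps)
    qed
    ultimately show ?thesis by simp
  qed
  \<comment> \<open>Second inversion: replace \<open>e\<close> by \<open>u\<close> in the quadratic term. With \<open>e = u + d\<close> the mixed terms
    \<open>b(u,d) + b(d,u) = 2 b(u,d)\<close> contribute \<open>b(u,b(u,u))\<close>; symmetry of \<open>b\<close> enters here.\<close>
  define rem_b where "rem_b x = b x (e x) (e x) - b x (u x) (u x) - b x (u x) (b x (u x) (u x))" for x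
  have rem_b: "vanishes_order \<alpha> 4 rem_b"
  proof -
    have "vanishes_order \<alpha> 4 (\<lambda>x. 2 *\<^sub>R b x (u x) (q x) + b x (d x) (d x))"
      by (intro combine b[OF u q] b[OF d d]) auto
    moreover have "\<forall>\<^sub>F x in nhds \<alpha>. 2 *\<^sub>R b x (u x) (q x) + b x (d x) (d x) = rem_b x"
      using b_sym
    proof eventually_elim
      case (elim x)
      have "b x (e x) (e x) = b x (u x) (u x) + b x (u x) (d x) + b x (d x) (u x) + b x (d x) (d x)"
        by (simp add: d_def b_simps)
      moreover have "b x (d x) (u x) = b x (u x) (d x)" using elim by blast
      moreover have "2 *\<^sub>R b x (u x) (d x) = 2 *\<^sub>R b x (u x) (q x) + b x (u x) (b x (u x) (u x))"
        by (simp add: q_def b_simps blinfun.scaleR_right scaleR_diff_right)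
      ultimately show ?case by (simp add: rem_b_def algebra_simps flip: scaleR_2)
    qed
    ultimately show ?thesis by (rule vanishes_order_transform)
  qed
  define rem_c where "rem_c x = c x (e x) (e x) (e x) - c x (u x) (u x) (u x)" for x
  have rem_c: "vanishes_order \<alpha> 4 rem_c"
  proof -
    have "vanishes_order \<alpha> 4 (\<lambda>x. c x (d x) (e x) (e x) + c x (u x) (d x) (e x)
      + c x (u x) (u x) (d x))"
      by (intro combine c[OF d e e] c[OF u d e] c[OF u u d]) auto
    then show ?thesis
      by (simp add: rem_c_def[abs_def] d_def c_def blinfun.diff_left blinfun.diff_right)
  qed

  \<comment> \<open>Taylor's formula for \<open>F1\<close> at \<open>x\<close> with displacement \<open>-(2/3) u\<close>\<close>
  define P where "P x = F1 x - F1 (x - (2/3) *\<^sub>R u x)" for x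
  define Q where "Q x = P x - (2/3) *\<^sub>R F2 x (u x) + (2/9) *\<^sub>R F3 x (u x) (u x)" for x
  have S_eq: "S x v = L x (P x v)" for x v by (simp add: S_def P_def)
  have Q: "vanishes_order \<alpha> 3 Q"
  proof -
    let ?h = "\<lambda>x. (- (2/3)) *\<^sub>R u x"
    have "vanishes_order \<alpha> 3 (\<lambda>x. F1 (x + ?h x) - (F1 x + F2 x (?h x)
      + (1/2) *\<^sub>R F3 x (?h x) (?h x)))"
      by (rule vanishes_order_Taylor3[OF D F(2-4) F4' vanishes_order_scaleR[OF u]])
    then have "vanishes_order \<alpha> 3 (\<lambda>x. - (F1 (x + ?h x) - (F1 x + F2 x (?h x)
      + (1/2) *\<^sub>R F3 x (?h x) (?h x))))" by (rule vanishes_order_minus)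
    then show ?thesis
      by (simp add: Q_def[abs_def] P_def blinfun.scaleR_right blinfun.scaleR_left blinfun.minus_right
        blinfun.minus_left algebra_simps)
  qed
  have F3uu: "vanishes_order \<alpha> 2 (\<lambda>x. F3 x (u x) (u x))"
    by (rule apply_rule[OF apply_rule[OF F3 u] u]) auto
  have F2u: "vanishes_order \<alpha> 1 (\<lambda>x. F2 x (u x))"
    by (rule apply_rule[OF F2 u]) auto
  have P2: "vanishes_order \<alpha> 2 (\<lambda>x. P x - (2/3) *\<^sub>R F2 x (u x))"
  proof -
    have "vanishes_order \<alpha> 2 (\<lambda>x. Q x - (2/9) *\<^sub>R F3 x (u x) (u x))"
      by (intro combine F3uu vanishes_order_mono[OF Q]) auto
    then show ?thesis by (simp add: Q_def)
  qed
  have P: "vanishes_order \<alpha> 1 P"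
  proof -
    have "vanishes_order \<alpha> 1 (\<lambda>x. (P x - (2/3) *\<^sub>R F2 x (u x)) + (2/3) *\<^sub>R F2 x (u x))"
      by (intro combine F2u vanishes_order_mono[OF P2]) auto
    then show ?thesis by simp
  qed
  have S: "vanishes_order \<alpha> n (\<lambda>x. S x (f x))" if "vanishes_order \<alpha> i f" "n = i + 1" for f i n
    unfolding S_eq using that by (auto intro!: apply_rule[OF L apply_rule[OF P]])
  define rem_S where "rem_S x = S x (u x) - (2/3) *\<^sub>R b x (u x) (u x)
    + (2/9) *\<^sub>R c x (u x) (u x) (u x)" for x
  have rem_S: "vanishes_order \<alpha> 4 rem_S"
  proof -
    have "vanishes_order \<alpha> 4 (\<lambda>x. L x (Q x (u x)))"
      by (rule apply_rule[OF L apply_rule[OF Q u]]) auto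
    then show ?thesis
      by (simp add: rem_S_def[abs_def] S_eq Q_def b_def c_def blinfun.scaleR_right blinfun.scaleR_left
        blinfun.add_left blinfun.diff_left blinfun.add_right blinfun.diff_right)
  qed
  have cuuu: "vanishes_order \<alpha> 3 (\<lambda>x. c x (u x) (u x) (u x))" by (rule c[OF u u u]) simp
  define rem_SS where "rem_SS x = S x (S x (u x)) - (4/9) *\<^sub>R b x (u x) (b x (u x) (u x))" for x
  have rem_SS: "vanishes_order \<alpha> 4 rem_SS"
  proof -
    have "vanishes_order \<alpha> 3 (\<lambda>x. rem_S x - (2/9) *\<^sub>R c x (u x) (u x) (u x))"
      by (intro combine cuuu vanishes_order_mono[OF rem_S]) auto
    then have Su: "vanishes_order \<alpha> 3 (\<lambda>x. S x (u x) - (2/3) *\<^sub>R b x (u x) (u x))"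
      by (simp add: rem_S_def)
    have "vanishes_order \<alpha> 4 (\<lambda>x. S x (S x (u x) - (2/3) *\<^sub>R b x (u x) (u x))
      + (2/3) *\<^sub>R L x ((P x - (2/3) *\<^sub>R F2 x (u x)) (b x (u x) (u x))))"
      by (intro combine S[OF Su] apply_rule[OF L apply_rule[OF P2 buu]]) auto
    then show ?thesis
      by (simp add: rem_SS_def[abs_def] S_eq b_def blinfun.scaleR_right blinfun.scaleR_left
        blinfun.diff_left blinfun.diff_right algebra_simps)
  qed
  define SSS where "SSS x = S x (S x (S x (u x)))" for x
  have SSS: "vanishes_order \<alpha> 4 SSS"
    unfolding SSS_def by (rule S[OF S[OF S[OF u]]]) auto

  \<comment> \<open>All terms below fourth order cancel in this combination. The coefficients of \<open>rem_b\<close> and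
    \<open>rem_c\<close> come from the Taylor formula for \<open>F\<close>, those of \<open>rem_S\<close>, \<open>rem_SS\<close> and \<open>SSS\<close> from the
    weight.\<close>
  have "vanishes_order \<alpha> 4 (\<lambda>x. (1/2) *\<^sub>R rem_b x - (1/6) *\<^sub>R rem_c x - (3/4) *\<^sub>R rem_S x
    - (9/8) *\<^sub>R rem_SS x - (1/2) *\<^sub>R SSS x - rem_u x)"
    by (intro combine rem_u rem_S rem_SS SSS rem_b rem_c)
  moreover have "(1/2) *\<^sub>R rem_b x - (1/6) *\<^sub>R rem_c x - (3/4) *\<^sub>R rem_S x
    - (9/8) *\<^sub>R rem_SS x - (1/2) *\<^sub>R SSS x - rem_u x
    = x - (u x + (3/4) *\<^sub>R S x (u x) + (9/8) *\<^sub>R S x (S x (u x))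
      + (1/2) *\<^sub>R S x (S x (S x (u x)))) - \<alpha>" for x
    unfolding rem_u_def rem_S_def rem_SS_def SSS_def rem_b_def rem_c_def
    by (simp add: e_def algebra_simps)
  ultimately show "vanishes_order \<alpha> 4 (\<lambda>x. x - (u x + (3/4) *\<^sub>R S x (u x)
      + (9/8) *\<^sub>R S x (S x (u x)) + (1/2) *\<^sub>R S x (S x (S x (u x)))) - \<alpha>)"
    by simp
qed

section \<open>Convergence of the sequence\<close>

text \<open>
  For \<open>p \<ge> 2\<close> the bound \<open>C |x - \<alpha>|^p\<close> is at most \<open>|x - \<alpha>| / 2\<close> on a small ball, which is therefore
  invariant. The property \<open>P\<close> collects what each iterate needs for the next step to be defined.
\<close>
lemma iteration_converges_with_order:
  fixes \<Phi> :: "'a::real_normed_vector \<Rightarrow> 'a"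
  assumes step: "vanishes_order \<alpha> p (\<lambda>x. \<Phi> x - \<alpha>)" and p: "2 \<le> p"
    and P: "\<forall>\<^sub>F x in nhds \<alpha>. P x"
  obtains U where "open U" "\<alpha> \<in> U" "\<And>x. x \<in> U \<Longrightarrow> P x"
    "\<And>X k. X 0 \<in> U \<Longrightarrow> (\<And>k. X (Suc k) = \<Phi> (X k)) \<Longrightarrow> X k \<in> U"
    "\<And>X. X 0 \<in> U \<Longrightarrow> (\<And>k. X (Suc k) = \<Phi> (X k)) \<Longrightarrow> converges_with_order X \<alpha> p"
proof -
  obtain C where C: "C \<ge> 0" "\<forall>\<^sub>F x in nhds \<alpha>. norm (\<Phi> x - \<alpha>) \<le> C * norm (x - \<alpha>) ^ p"
    using step by (rule vanishes_orderE)
  obtain r where r: "0 < r"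
    "\<And>x. dist x \<alpha> < r \<Longrightarrow> norm (\<Phi> x - \<alpha>) \<le> C * norm (x - \<alpha>) ^ p \<and> P x"
    using eventually_conj[OF C(2) P] unfolding eventually_nhds_metric by blast
  \<comment> \<open>\<open>\<rho> \<le> 1\<close> reduces the power \<open>p\<close> to \<open>2\<close>; \<open>C + 1\<close> covers the case \<open>C = 0\<close>\<close>
  define \<rho> where "\<rho> = min r (min 1 (1 / (2 * (C + 1))))"
  have \<rho>: "0 < \<rho>" "\<rho> \<le> r" "\<rho> \<le> 1" "\<rho> \<le> 1 / (2 * (C + 1))"
    using r C by (auto simp: \<rho>_def min_le_iff_disj)
  have C\<rho>: "C * \<rho> \<le> 1/2"
  proof -
    have "C * \<rho> \<le> C * (1 / (2 * (C + 1)))" using \<rho>(4) C(1) by (rule mult_left_mono)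
    also have "\<dots> \<le> 1/2" using C(1) by (simp add: field_simps)
    finally show ?thesis .
  qed
  have err: "norm (\<Phi> x - \<alpha>) \<le> C * norm (x - \<alpha>) ^ p" if "x \<in> ball \<alpha> \<rho>" for x
    using that \<rho>(2) r(2)[of x] by (simp add: dist_commute)
  have half: "norm (\<Phi> x - \<alpha>) \<le> (1/2) * norm (x - \<alpha>)" if x: "x \<in> ball \<alpha> \<rho>" for x
  proof -
    have small: "norm (x - \<alpha>) \<le> \<rho>" using x by (simp add: dist_norm norm_minus_commute)
    have "norm (x - \<alpha>) ^ p \<le> norm (x - \<alpha>) ^ 2"
      using small \<rho>(3) p by (intro power_decreasing) auto
    with err[OF x] have "norm (\<Phi> x - \<alpha>) \<le> C * norm (x - \<alpha>) ^ 2"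
      using C(1) by (meson mult_left_mono order_trans)
    also have "\<dots> = (C * norm (x - \<alpha>)) * norm (x - \<alpha>)" by (simp add: power2_eq_square)
    also have "\<dots> \<le> (1/2) * norm (x - \<alpha>)"
      using mult_left_mono[OF small C(1)] C\<rho> by (intro mult_right_mono) auto
    finally show ?thesis .
  qed
  have decay: "X k \<in> ball \<alpha> \<rho> \<and> norm (X k - \<alpha>) \<le> (1/2) ^ k * norm (X 0 - \<alpha>)"
    if X: "X 0 \<in> ball \<alpha> \<rho>" "\<And>k. X (Suc k) = \<Phi> (X k)" for X k
  proof (induction k)
    case (Suc k)
    then have "norm (X (Suc k) - \<alpha>) \<le> (1/2) * norm (X k - \<alpha>)" using half X(2) by simp
    moreover have "norm (X k - \<alpha>) < \<rho>" using Suc by (simp add: dist_norm norm_minus_commute)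
    ultimately have "norm (X (Suc k) - \<alpha>) < \<rho>"
        "norm (X (Suc k) - \<alpha>) \<le> (1/2) * ((1/2) ^ k * norm (X 0 - \<alpha>))"
      using Suc norm_ge_zero[of "X k - \<alpha>"] by linarith+
    then show ?case by (simp add: dist_norm norm_minus_commute)
  qed (use X in simp)
  show thesis
  proof (rule that[of "ball \<alpha> \<rho>"])
    show "P x" if "x \<in> ball \<alpha> \<rho>" for x using that \<rho>(2) r(2)[of x] by (simp add: dist_commute)
    show "X k \<in> ball \<alpha> \<rho>" if "X 0 \<in> ball \<alpha> \<rho>" "\<And>k. X (Suc k) = \<Phi> (X k)" for X k
      using decay[OF that] by blast
    show "converges_with_order X \<alpha> p"
      if X: "X 0 \<in> ball \<alpha> \<rho>" "\<And>k. X (Suc k) = \<Phi> (X k)" for X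
      unfolding converges_with_order_def
    proof (intro conjI exI allI)
      have "(\<lambda>k. (1/2) ^ k * norm (X 0 - \<alpha>)) \<longlonglongrightarrow> 0 * norm (X 0 - \<alpha>)"
        by (intro tendsto_intros LIMSEQ_power_zero) simp
      then have "(\<lambda>k. X k - \<alpha>) \<longlonglongrightarrow> 0"
        using decay[OF X] by (intro Lim_null_comparison[of "\<lambda>k. X k - \<alpha>"]) auto
      then show "X \<longlonglongrightarrow> \<alpha>" by (simp add: LIM_zero_iff)
      show "norm (X (Suc k) - \<alpha>) \<le> C * norm (X k - \<alpha>) ^ p" for k
        using err decay[OF X] X(2) by simp
    qed
  qed (use \<rho> in auto)
qed

section \<open>Matrix form of the iteration\<close>

lemma jac_eq_frechet_derivative:
  fixes F :: "real^'n \<Rightarrow> real^'n"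
  assumes "(F has_derivative blinfun_apply A) (at x)"
  shows "jac F x *v v = A v"
proof -
  have "(F has_derivative (\<lambda>h. jac F x *v h)) (at x)"
    using assms jacobian_works differentiable_def by blast
  from has_derivative_unique[OF this assms] show ?thesis by metis
qed

lemma matrix_inv_inverts:
  fixes A :: "real^'n^'n"
  assumes "invertible A"
  shows "matrix_inv A *v (A *v v) = v" "A *v (matrix_inv A *v v) = v"
proof -
  have "A ** matrix_inv A = mat 1 \<and> matrix_inv A ** A = mat 1"
    using assms unfolding matrix_inv_def invertible_def by (rule someI_ex)
  then show "matrix_inv A *v (A *v v) = v" "A *v (matrix_inv A *v v) = v"
    by (simp_all add: matrix_vector_mul_assoc)
qed

text \<open>
  The substitution \<open>T = I - S\<close>: the second factor of the weight is \<open>I + S/4 + S\<^sup>2\<close> and the first is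
  \<open>2 I + S\<close>. Linearity of \<open>S\<close> is inherited from \<open>T\<close>.
\<close>
lemma X_step_eq_power_sum:
  fixes F :: "real^'n \<Rightarrow> real^'n"
  assumes S: "\<And>v. T_mat F \<beta> x *v v = v - S v"
  shows "X_step F \<beta> (9/4) (-9/4) 1 x = x - (newton_corr F x + (3/4) *\<^sub>R S (newton_corr F x)
    + (9/8) *\<^sub>R S (S (newton_corr F x)) + (1/2) *\<^sub>R S (S (S (newton_corr F x))))"
proof -
  have S': "S v = v - T_mat F \<beta> x *v v" for v using S[of v] by simp
  have S_diff: "S (v - w) = S v - S w" and S_scale: "S (r *\<^sub>R v) = r *\<^sub>R S v"
    and S_add: "S (v + w) = S v + S w" for v w r
    unfolding S' by (simp_all add: matrix_vector_mult_diff_distrib matrix_vector_right_distrib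
      matrix_vector_mult_scaleR algebra_simps)
  note mult_simps = matrix_vector_mul_assoc[symmetric] matrix_vector_mult_add_rdistrib
    matrix_vector_mult_diff_rdistrib scaleR_matrix_vector_assoc[symmetric] matrix_vector_mul_lid
  let ?T = "T_mat F \<beta> x" and ?u = "newton_corr F x"
  let ?w = "?u + (1/4) *\<^sub>R S ?u + S (S ?u)"
  have "((9/4) *\<^sub>R mat 1 + (-9/4) *\<^sub>R ?T + 1 *\<^sub>R (?T ** ?T)) *v ?u = ?w"
    by (simp only: mult_simps S S_diff) (simp add: vec_eq_iff field_simps)
  moreover have "(3 *\<^sub>R mat 1 - ?T) *v w = 2 *\<^sub>R w + S w" for w
    by (simp only: mult_simps S) (simp add: vec_eq_iff)
  ultimately have "X_step F \<beta> (9/4) (-9/4) 1 x = x - (1/2) *\<^sub>R (2 *\<^sub>R ?w + S ?w)"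
    by (simp only: X_step_def Let_def matrix_vector_mul_assoc[symmetric])
  then show ?thesis
    by (simp only: S_add S_scale) (simp add: vec_eq_iff field_simps)
qed

theorem theorem2p2:
  fixes D :: "(real^'n) set" and F :: "real^'n \<Rightarrow> real^'n" and \<alpha> :: "real^'n"
    and \<beta> a1 a2 a3 :: real
  assumes "open D" and "convex D"
    and "C6_on D F"
    and "\<alpha> \<in> D" and "F \<alpha> = 0"
    and "continuous_on D (\<lambda>x. jac F x)"
    and "\<And>x. x \<in> D \<Longrightarrow> invertible (jac F x)"
    and "\<beta> = 2/3" and "a1 = 9/4" and "a2 = -9/4" and "a3 = 1"
  shows "\<exists>U. open U \<and> \<alpha> \<in> U \<and> U \<subseteq> D \<and>
    (\<forall>X0\<in>U. iterates_well_defined D F \<beta> (X_seq F \<beta> a1 a2 a3 X0) \<and>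
             converges_with_order (X_seq F \<beta> a1 a2 a3 X0) \<alpha> 4)"
proof -
  note D = \<open>open D\<close> \<open>\<alpha> \<in> D\<close>
  obtain F1 F2 F3 F4 F5 where F: "frechet_derivative_on D F F1" "frechet_derivative_on D F1 F2"
    "frechet_derivative_on D F2 F3" "frechet_derivative_on D F3 F4" "frechet_derivative_on D F4 F5"
    using \<open>C6_on D F\<close> unfolding C6_on_def by blast
  have jac: "jac F x *v v = F1 x v" if "x \<in> D" for x v
    using F(1) that unfolding frechet_derivative_on_def by (blast intro: jac_eq_frechet_derivative)
  define L where "L x = Blinfun ((*v) (matrix_inv (jac F x)))" for x
  have L_apply: "L x v = matrix_inv (jac F x) *v v" for x v
    unfolding L_def by (simp add: bounded_linear_Blinfun_apply)
  have inv: "L x (F1 x v) = v" "F1 x (L x v) = v" if "x \<in> D" for x v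
    using matrix_inv_inverts[OF assms(7)[OF that], of v] jac[OF that] by (auto simp: L_apply)
  have nhdsD: "\<forall>\<^sub>F x in nhds \<alpha>. x \<in> D" by (rule eventually_nhds_in_open[OF D])
  have L: "vanishes_order \<alpha> 0 L"
  proof (rule inverse_derivative_locally_bounded)
    show "isCont F1 \<alpha>" by (rule frechet_derivative_on_isCont[OF F(2) D(2)])
    show "\<forall>\<^sub>F x in nhds \<alpha>. \<forall>w. F1 x (L x w) = w"
      using nhdsD by eventually_elim (simp add: inv)
  qed (simp add: inv D(2))
  let ?u = "\<lambda>x. L x (F x)"
  let ?S = "\<lambda>x v. L x ((F1 x - F1 (x - (2/3) *\<^sub>R L x (F x))) v)"
  have "\<forall>x\<in>D. \<forall>v. L x (F1 x v) = v" by (simp add: inv)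
  note step = weighted_newton_step_error[OF D \<open>F \<alpha> = 0\<close> F(1-4)
      frechet_derivative_on_isCont[OF F(5) D(2)] L this]
  have u: "newton_corr F x = ?u x" for x by (simp add: newton_corr_def L_apply)
  have Y: "Y_step F \<beta> x = x - (2/3) *\<^sub>R ?u x" for x
    by (simp add: Y_step_def u \<open>\<beta> = 2/3\<close>)
  have "\<forall>\<^sub>F x in nhds \<alpha>. x + (- (2/3)) *\<^sub>R ?u x \<in> D"
    by (rule vanishes_order_eventually_near[OF vanishes_order_scaleR[OF step(1)] D])
  then have YD: "\<forall>\<^sub>F x in nhds \<alpha>. Y_step F \<beta> x \<in> D" by (simp add: Y)
  have "\<forall>\<^sub>F x in nhds \<alpha>. x - (?u x + (3/4) *\<^sub>R ?S x (?u x) + (9/8) *\<^sub>R ?S x (?S x (?u x))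
      + (1/2) *\<^sub>R ?S x (?S x (?S x (?u x)))) - \<alpha> = X_step F \<beta> a1 a2 a3 x - \<alpha>"
    using nhdsD YD
  proof eventually_elim
    case (elim x)
    have "T_mat F \<beta> x *v v = v - ?S x v" for v
      using jac[OF elim(2)] inv[OF elim(1)]
      by (simp add: T_mat_def matrix_vector_mul_assoc[symmetric] L_apply[symmetric] Y
          blinfun.diff_left blinfun.diff_right)
    from X_step_eq_power_sum[OF this] show ?case
      by (simp add: u \<open>a1 = 9/4\<close> \<open>a2 = -9/4\<close> \<open>a3 = 1\<close>)
  qed
  with step(2) have "vanishes_order \<alpha> 4 (\<lambda>x. X_step F \<beta> a1 a2 a3 x - \<alpha>)"
    by (rule vanishes_order_transform)
  from iteration_converges_with_order[OF this _ eventually_conj[OF nhdsD YD]]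
  obtain U where U: "open U" "\<alpha> \<in> U" "\<And>x. x \<in> U \<Longrightarrow> x \<in> D \<and> Y_step F \<beta> x \<in> D"
    "\<And>X k. X 0 \<in> U \<Longrightarrow> (\<And>k. X (Suc k) = X_step F \<beta> a1 a2 a3 (X k)) \<Longrightarrow> X k \<in> U"
    "\<And>X. X 0 \<in> U \<Longrightarrow> (\<And>k. X (Suc k) = X_step F \<beta> a1 a2 a3 (X k)) \<Longrightarrow> converges_with_order X \<alpha> 4"
    by (auto simp: numeral_le_iff)
  show ?thesis
  proof (intro exI[of _ U] conjI ballI)
    fix X0 assume X0: "X0 \<in> U"
    let ?X = "X_seq F \<beta> a1 a2 a3 X0"
    have "?X k \<in> U" for k using U(4)[of ?X k] X0 by simp
    then show "iterates_well_defined D F \<beta> ?X"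
      unfolding iterates_well_defined_def using U(3) assms(7) by blast
    show "converges_with_order ?X \<alpha> 4" using U(5)[of ?X] X0 by simp
  qed (use U in auto)
qed

end
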